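(* Let $n\ge 3$, let $G_n$ be the straight linear 2-tree on $n$ vertices, and let $m=n-2$ (the number of triangles of $G_n$). For integers $j,k$ with $1\le j<n$, $k\ge 1$ and $j+k\le n$, the resistance distance $r_m(j,j+k)$ between vertices $j$ and $j+k$ of $G_n$ satisfies \[ r_m(j,j+k)=\frac{\sum_{i=1}^{k}\left[F_iF_{i+2j-2}-F_{i-1}F_{i+2j-3}\right]F_{2m-2i-2j+5}}{F_{2m+2}} \] \[ =\frac{F_{m+1}^2+F_k^2F_{m-2j-k+3}^2+\frac{F_{m+1}}{5}\left[F_{m-k}\left(kL_k-F_k\right)+F_{m-k+1}\left((k-5)F_{k+1}+(2k+2)F_{k}\right)\right]}{F_{2m+2}}. \]
   Context: The straight linear 2-tree $G_n$ is the graph with vertex set $\{1,2,\dots,n\}$ in which $\{i,j\}$ is an edge if and only if $0<|i-j|\le 2$. Each edge is regarded as a unit resistor; the resistance distance between vertices $i,j$ of a graph $G$ with Laplacian $L(G)$ is $r_G(i,j)=(\mathbf e_i-\mathbf e_j)^TL(G)^{\dagger}(\mathbf e_i-\mathbf e_j)$, where $L(G)^\dagger$ is the Moore–Penrose inverse. $F_p$ denotes the Fibonacci numbers ($F_0=0$, $F_1=1$, $F_{p+1}=F_p+F_{p-1}$, extended to all integers $p$ by this recurrence, so $F_{-p}=(-1)^{p+1}F_p$), and $L_p=F_{p-1}+F_{p+1}$ denotes the Lucas numbers. *)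

theory Defs
  imports "Jordan_Normal_Form.Matrix" "HOL-Number_Theory.Fib"
begin

text \<open>A simple graph on \<open>{1..n}\<close> is given by its set of two-element edges. Matrix rows and
  columns are numbered from 0, so vertex \<open>v\<close> has index \<open>v - 1\<close>.\<close>

definition graph_laplacian :: "nat \<Rightarrow> nat set set \<Rightarrow> real mat" where
  "graph_laplacian n E = mat n n (\<lambda>(a, b).
     if a = b then real (card {e \<in> E. Suc a \<in> e})
     else if {Suc a, Suc b} \<in> E then - 1 else 0)"

definition is_moore_penrose_inverse :: "real mat \<Rightarrow> real mat \<Rightarrow> bool" where
  "is_moore_penrose_inverse A X \<longleftrightarrow>
     X \<in> carrier_mat (dim_col A) (dim_row A) \<and>
     A * X * A = A \<and> X * A * X = X \<and>
     transpose_mat (A * X) = A * X \<and> transpose_mat (X * A) = X * A"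

definition moore_penrose_inverse :: "real mat \<Rightarrow> real mat" where
  "moore_penrose_inverse A = (THE X. is_moore_penrose_inverse A X)"

lemma is_moore_penrose_inverse_unique:
  assumes "is_moore_penrose_inverse A X" and "is_moore_penrose_inverse A Y"
  shows "X = Y"
proof -
  define m n where "m = dim_row A" and "n = dim_col A"
  have A: "A \<in> carrier_mat m n" by (simp add: m_def n_def)
  have X: "X \<in> carrier_mat n m" and Y: "Y \<in> carrier_mat n m"
    and AXA: "A * X * A = A" and XAX: "X * A * X = X"
    and AX: "transpose_mat (A * X) = A * X" and XA: "transpose_mat (X * A) = X * A"
    and AYA: "A * Y * A = A" and YAY: "Y * A * Y = Y"
    and AY: "transpose_mat (A * Y) = A * Y" and YA: "transpose_mat (Y * A) = Y * A"
    using assms by (auto simp: is_moore_penrose_inverse_def m_def n_def)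
  have cAX: "A * X \<in> carrier_mat m m" and cAY: "A * Y \<in> carrier_mat m m"
    and cXA: "X * A \<in> carrier_mat n n" and cYA: "Y * A \<in> carrier_mat n n"
    using A X Y by auto
  have "A * X = (A * Y) * (A * X)"
    using AYA assoc_mult_mat[OF cAY A X] by simp
  then have "transpose_mat (A * X) = transpose_mat ((A * Y) * (A * X))" by simp
  also have "\<dots> = (A * X) * (A * Y)"
    using transpose_mult[OF cAY cAX] AX AY by simp
  also have "\<dots> = A * Y"
    using AXA assoc_mult_mat[OF cAX A Y] by simp
  finally have eq1: "A * X = A * Y" using AX by simp
  have "X * A = (X * A) * (Y * A)"
    using AYA assoc_mult_mat[OF X A cYA] assoc_mult_mat[OF A Y A] by simp
  then have "transpose_mat (X * A) = transpose_mat ((X * A) * (Y * A))" by simp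
  also have "\<dots> = (Y * A) * (X * A)"
    using transpose_mult[OF cXA cYA] XA YA by simp
  also have "\<dots> = Y * A"
    using AXA assoc_mult_mat[OF Y A cXA] assoc_mult_mat[OF A X A] by simp
  finally have eq2: "X * A = Y * A" using XA by simp
  have "X = Y * A * X" using XAX eq2 by simp
  also have "\<dots> = Y * (A * Y)" using assoc_mult_mat[OF Y A X] eq1 by simp
  also have "\<dots> = Y" using assoc_mult_mat[OF Y A Y] YAY by simp
  finally show ?thesis .
qed

lemma moore_penrose_inverse_eqI:
  "is_moore_penrose_inverse A X \<Longrightarrow> moore_penrose_inverse A = X"
  unfolding moore_penrose_inverse_def
  by (blast intro: the_equality is_moore_penrose_inverse_unique)

definition resistance_distance :: "nat \<Rightarrow> nat set set \<Rightarrow> nat \<Rightarrow> nat \<Rightarrow> real" where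
  "resistance_distance n E i j =
     (let d = unit_vec n (i - 1) - unit_vec n (j - 1)
      in d \<bullet> (moore_penrose_inverse (graph_laplacian n E) *\<^sub>v d))"

definition straight_2tree_edges :: "nat \<Rightarrow> nat set set" where
  "straight_2tree_edges n =
     {{i, j} | i j. i \<in> {1..n} \<and> j \<in> {1..n} \<and>
        0 < \<bar>int i - int j\<bar> \<and> \<bar>int i - int j\<bar> \<le> 2}"

definition fib_int :: "int \<Rightarrow> int" where
  "fib_int p = (if p \<ge> 0 then int (fib (nat p))
                else (- 1) ^ (nat (- p) + 1) * int (fib (nat (- p))))"

definition lucas_int :: "int \<Rightarrow> int" where
  "lucas_int p = fib_int (p - 1) + fib_int (p + 1)"

abbreviation F :: "int \<Rightarrow> real" where
  "F p \<equiv> real_of_int (fib_int p)"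

abbreviation L :: "int \<Rightarrow> real" where
  "L p \<equiv> real_of_int (lucas_int p)"

lemma fib_int_of_nat: "fib_int (int p) = int (fib p)"
  by (simp add: fib_int_def)

lemma fib_int_neg_of_nat: "fib_int (- int p) = (- 1) ^ (p + 1) * int (fib p)"
  by (cases "p = 0") (auto simp: fib_int_def)

lemma fib_int_rec: "fib_int (p + 1) = fib_int p + fib_int (p - 1)"
proof -
  consider q where "p = int (Suc q)" | "p = 0" | q where "p = - int (Suc q)"
    by (metis int_cases2 not0_implies_Suc of_nat_0 neg_equal_0_iff_equal)
  then show ?thesis
  proof cases
    case 1
    then have "p + 1 = int (Suc (Suc q))" "p - 1 = int q" by simp_all
    with 1 show ?thesis by (simp only: fib_int_of_nat) simp
  next
    case 2
    then show ?thesis by (simp add: fib_int_def)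
  next
    case 3
    then have "p + 1 = - int q" "p - 1 = - int (Suc (Suc q))" by simp_all
    with 3 show ?thesis by (simp only: fib_int_neg_of_nat) (simp add: algebra_simps)
  qed
qed

end

theory Submission
  imports Defs "Jordan_Normal_Form.Determinant"
begin

text \<open>The resistance distance is the potential difference \<open>v\<^sub>j - v\<^sub>j\<^sub>+\<^sub>k\<close> for any solution of
  \<open>L v = e\<^sub>j - e\<^sub>j\<^sub>+\<^sub>k\<close>. In terms of the drops \<open>x\<^sub>i = v\<^sub>i - v\<^sub>i\<^sub>+\<^sub>1\<close>, the current through the cut
  between \<open>i\<close> and \<open>i + 1\<close> is \<open>x\<^sub>i\<^sub>-\<^sub>1 + 3 x\<^sub>i + x\<^sub>i\<^sub>+\<^sub>1\<close>, with the boundary convention \<open>x\<^sub>0 = - x\<^sub>1\<close>,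
  \<open>x\<^sub>n = - x\<^sub>n\<^sub>-\<^sub>1\<close>. The Green function of this tridiagonal system is an alternating product of
  odd-indexed Fibonacci numbers, and summing it over \<open>{j..<j+k}\<times>{j..<j+k}\<close>, grouped by the larger
  index, gives the first formula. The second follows by induction on \<open>k\<close> from
  \<open>F\<^sub>p\<^sup>2 + F\<^sub>q\<^sup>2 = F\<^sub>p\<^sub>+\<^sub>q F\<^sub>p\<^sub>-\<^sub>q\<close> for odd \<open>p - q\<close>.\<close>

subsection \<open>Moore--Penrose inverses and potentials\<close>

text \<open>With \<open>J\<close> the projection onto the constants, the inverse is \<open>(A + J)\<^sup>-\<^sup>1 - J\<close>.\<close>

lemma moore_penrose_exists:
  fixes A :: "real mat"
  assumes A: "A \<in> carrier_mat n n" and n: "n > 0"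
    and sym: "transpose_mat A = A"
    and one: "A *\<^sub>v vec n (\<lambda>_. 1) = 0\<^sub>v n"
    and ker: "\<And>w a b. w \<in> carrier_vec n \<Longrightarrow> A *\<^sub>v w = 0\<^sub>v n \<Longrightarrow> a < n \<Longrightarrow> b < n \<Longrightarrow> w $ a = w $ b"
  shows "\<exists>X. is_moore_penrose_inverse A X"
proof -
  define J :: "real mat" where "J = mat n n (\<lambda>_. 1 / real n)"
  define M where "M = A + J"
  have J[simp]: "J \<in> carrier_mat n n" by (simp add: J_def)
  note A[simp] carrier_matD[OF A, simp]
  have M[simp]: "M \<in> carrier_mat n n" by (simp add: M_def)
  have Jsym: "transpose_mat J = J" by (intro eq_matI) (auto simp: J_def)
  have JJ: "J * J = J"
    using n by (intro eq_matI) (auto simp: J_def scalar_prod_def)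
  have rowsum: "(\<Sum>c<n. A $$ (a, c)) = 0" if "a < n" for a
    using arg_cong[OF one, of "\<lambda>v. v $ a"] that A
    by (simp add: scalar_prod_def atLeast0LessThan)
  have AJ: "A * J = 0\<^sub>m n n"
    using rowsum by (intro eq_matI)
      (auto simp: J_def scalar_prod_def atLeast0LessThan simp flip: sum_divide_distrib)
  have JA: "J * A = 0\<^sub>m n n"
    using transpose_mult[OF A J] AJ sym Jsym by simp
  \<comment> \<open>\<open>M\<close> is injective: applying \<open>J\<close> gives
    \<open>J w = 0\<close>, then \<open>A w = 0\<close>, so \<open>w\<close> is constant with zero
    sum.\<close>
  have "w = 0\<^sub>v n" if w[simp]: "w \<in> carrier_vec n" and Mw: "M *\<^sub>v w = 0\<^sub>v n" for w
  proof -
    have "J *\<^sub>v (M *\<^sub>v w) = (J * M) *\<^sub>v w" by (simp add: assoc_mult_mat_vec[OF J M w])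
    also have "J * M = J" by (simp add: M_def mult_add_distrib_mat[OF J A J] JA JJ)
    also have "J *\<^sub>v (M *\<^sub>v w) = 0\<^sub>v n" unfolding Mw by (intro eq_vecI) (auto simp: J_def)
    finally have Jw: "J *\<^sub>v w = 0\<^sub>v n" ..
    then have "A *\<^sub>v w = 0\<^sub>v n"
      using Mw by (simp add: M_def add_mult_distrib_mat_vec[OF A J w]
          right_zero_vec[OF mult_mat_vec_carrier[OF A w]])
    then have const: "w $ a = w $ 0" if "a < n" for a by (rule ker[OF w _ that n])
    have "(\<Sum>c<n. w $ c) = 0"
      using arg_cong[OF Jw, of "\<lambda>v. v $ 0"] n w
      by (simp add: J_def scalar_prod_def atLeast0LessThan flip: sum_divide_distrib)
    moreover have "(\<Sum>c<n. w $ c) = (\<Sum>c<n. w $ 0)" by (intro sum.cong refl const) simp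
    ultimately have w0: "w $ 0 = 0" using n by simp
    have "w $ a = 0" if "a < n" for a using const[OF that] w0 by simp
    then show ?thesis using w by (intro eq_vecI) auto
  qed
  then have "det M \<noteq> 0" using det_0_iff_vec_prod_zero_field[OF M] by blast
  then obtain N where N[simp]: "N \<in> carrier_mat n n" and MN: "M * N = 1\<^sub>m n" and NM: "N * M = 1\<^sub>m n"
    using det_non_zero_imp_unit[OF M] by (auto simp: Units_def ring_mat_def)
  have MJ: "M * J = J" by (simp add: M_def add_mult_distrib_mat[OF A J J] AJ JJ)
  have JM: "J * M = J" by (simp add: M_def mult_add_distrib_mat[OF J A J] JA JJ)
  have NJ: "N * J = J" using assoc_mult_mat[OF N M J] NM MJ left_mult_one_mat[OF J] by simp
  have JN: "J * N = J" using assoc_mult_mat[OF J M N] MN JM right_mult_one_mat[OF J] by simp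
  define X where "X = N - J"
  \<comment> \<open>\<open>P\<close> is the orthogonal projection onto the zero-sum vectors; both
    \<open>A * X\<close> and \<open>X * A\<close> turn out to be \<open>P\<close>.\<close>
  define P where "P = 1\<^sub>m n - J"
  have X[simp]: "X \<in> carrier_mat n n" by (simp only: X_def minus_carrier_mat[OF J])
  have P[simp]: "P \<in> carrier_mat n n" by (simp only: P_def minus_carrier_mat[OF J])
  have A_eq: "A = M - J" by (intro eq_matI) (use A in \<open>auto simp: M_def J_def\<close>)
  have JX: "J * X = 0\<^sub>m n n" by (simp add: X_def mult_minus_distrib_mat[OF J N J] JN JJ)
  have XJ: "X * J = 0\<^sub>m n n" by (simp add: X_def minus_mult_distrib_mat[OF N J J] NJ JJ)
  have z: "B - 0\<^sub>m n n = B" if "B \<in> carrier_mat n n" for B :: "real mat"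
    using that by (intro eq_matI) auto
  have MX: "M * X = P" by (simp add: X_def P_def mult_minus_distrib_mat[OF M N J] MN MJ)
  have XM: "X * M = P" by (simp add: X_def P_def minus_mult_distrib_mat[OF N J M] NM JM)
  have AX: "A * X = P"
    by (simp add: A_eq minus_mult_distrib_mat[OF M J X] MX JX z)
  have XA: "X * A = P"
    by (simp add: A_eq mult_minus_distrib_mat[OF X M J] XM XJ z)
  have Psym: "transpose_mat P = P"
    by (intro eq_matI) (auto simp: P_def J_def)
  have PA: "P * A = A"
    by (simp add: P_def minus_mult_distrib_mat[OF one_carrier_mat J A] JA left_mult_one_mat[OF A] z)
  have PX: "P * X = X"
    by (simp add: P_def minus_mult_distrib_mat[OF one_carrier_mat J X] JX left_mult_one_mat[OF X] z)
  have "is_moore_penrose_inverse A X"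
    unfolding is_moore_penrose_inverse_def using A by (simp add: AX XA PA PX Psym)
  then show ?thesis by blast
qed

text \<open>Symmetry moves one factor \<open>A\<close> across the product, and
  \<open>A * X * A = A\<close> removes \<open>X\<close>.\<close>

lemma moore_penrose_quadratic_form:
  fixes A :: "real mat"
  assumes A: "A \<in> carrier_mat n n" and sym: "transpose_mat A = A"
    and X: "is_moore_penrose_inverse A X"
    and v: "v \<in> carrier_vec n"
  shows "(A *\<^sub>v v) \<bullet> (X *\<^sub>v (A *\<^sub>v v)) = v \<bullet> (A *\<^sub>v v)"
proof -
  have Xc: "X \<in> carrier_mat n n" and AXA: "A * X * A = A"
    using X A by (auto simp: is_moore_penrose_inverse_def)
  have XAv: "X *\<^sub>v (A *\<^sub>v v) \<in> carrier_vec n" using Xc A v by simp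
  have "(A *\<^sub>v v) \<bullet> (X *\<^sub>v (A *\<^sub>v v)) = v \<bullet> (A *\<^sub>v (X *\<^sub>v (A *\<^sub>v v)))"
    using transpose_vec_mult_scalar[OF A XAv v] sym by simp
  also have "A *\<^sub>v (X *\<^sub>v (A *\<^sub>v v)) = A * X * A *\<^sub>v v"
    using A Xc v by (simp add: assoc_mult_mat_vec[of _ n n _ n])
  finally show ?thesis by (simp add: AXA)
qed

section \<open>Graph Laplacians and resistance as a potential difference\<close>

lemma graph_laplacian_carrier: "graph_laplacian n E \<in> carrier_mat n n"
  by (simp add: graph_laplacian_def)

lemma transpose_graph_laplacian: "transpose_mat (graph_laplacian n E) = graph_laplacian n E"
  by (intro eq_matI) (auto simp: graph_laplacian_def insert_commute)

lemma graph_laplacian_mult_vec: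
  assumes E: "E \<subseteq> {{i, j} | i j. i \<in> {1..n} \<and> j \<in> {1..n} \<and> i \<noteq> j}"
    and w: "w \<in> carrier_vec n" and a: "a < n"
  shows "(graph_laplacian n E *\<^sub>v w) $ a =
    (\<Sum>b | b < n \<and> b \<noteq> a \<and> {Suc a, Suc b} \<in> E. w $ a - w $ b)"
proof -
  let ?N = "{b. b < n \<and> b \<noteq> a \<and> {Suc a, Suc b} \<in> E}"
  have "bij_betw (\<lambda>b. {Suc a, Suc b}) ?N {e \<in> E. Suc a \<in> e}"
    unfolding bij_betw_def
  proof
    show "inj_on (\<lambda>b. {Suc a, Suc b}) ?N" by (auto simp: inj_on_def doubleton_eq_iff)
    have "e \<in> (\<lambda>b. {Suc a, Suc b}) ` ?N" if e: "e \<in> E" "Suc a \<in> e" for e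
    proof -
      obtain c where c: "e = {Suc a, c}" "c \<in> {1..n}" "c \<noteq> Suc a"
        using e E by (fastforce simp: insert_commute)
      then show ?thesis using e by (intro image_eqI[of _ _ "c - 1"]) auto
    qed
    then show "(\<lambda>b. {Suc a, Suc b}) ` ?N = {e \<in> E. Suc a \<in> e}" by auto
  qed
  then have card: "card {e \<in> E. Suc a \<in> e} = card ?N" by (simp add: bij_betw_same_card)
  have "(graph_laplacian n E *\<^sub>v w) $ a = (\<Sum>b<n. graph_laplacian n E $$ (a, b) * w $ b)"
    using a w by (simp add: graph_laplacian_def scalar_prod_def atLeast0LessThan)
  also have "\<dots> = graph_laplacian n E $$ (a, a) * w $ a
      + (\<Sum>b\<in>{..<n} - {a}. graph_laplacian n E $$ (a, b) * w $ b)"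
    using a by (subst sum.remove[of _ a]) auto
  also have "(\<Sum>b\<in>{..<n} - {a}. graph_laplacian n E $$ (a, b) * w $ b) = (\<Sum>b\<in>?N. - w $ b)"
    using a by (intro sum.mono_neutral_cong_right) (auto simp: graph_laplacian_def)
  also have "graph_laplacian n E $$ (a, a) * w $ a = (\<Sum>b\<in>?N. w $ a)"
    using a by (simp add: graph_laplacian_def card)
  finally show ?thesis by (simp add: sum_subtractf sum_negf)
qed

lemma graph_laplacian_mult_one:
  assumes "E \<subseteq> {{i, j} | i j. i \<in> {1..n} \<and> j \<in> {1..n} \<and> i \<noteq> j}"
  shows "graph_laplacian n E *\<^sub>v vec n (\<lambda>_. 1) = 0\<^sub>v n"
proof (intro eq_vecI)
  fix a assume "a < dim_vec (0\<^sub>v n :: real vec)"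
  then show "(graph_laplacian n E *\<^sub>v vec n (\<lambda>_. 1)) $ a = 0\<^sub>v n $ a"
    by (simp add: graph_laplacian_mult_vec[OF assms])
qed (simp add: graph_laplacian_def)

lemma scalar_prod_unit_vec_diff:
  fixes w :: "real vec"
  assumes "w \<in> carrier_vec n" "a < n" "b < n"
  shows "w \<bullet> (unit_vec n a - unit_vec n b) = w $ a - w $ b"
  using assms by (simp add: scalar_prod_minus_distrib[of _ n])

text \<open>Replaces the pseudoinverse by one solution \<open>v\<close> of a linear system.
  Solvability for all pairs, \<open>pot\<close>, determines the kernel and thereby yields existence
  of the inverse.\<close>

lemma resistance_distance_eq_potential_difference:
  assumes E: "E \<subseteq> {{i, j} | i j. i \<in> {1..n} \<and> j \<in> {1..n} \<and> i \<noteq> j}"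
    and pot: "\<And>a b. a < b \<Longrightarrow> b < n \<Longrightarrow> \<exists>u \<in> carrier_vec n.
      graph_laplacian n E *\<^sub>v u = unit_vec n a - unit_vec n b"
    and v: "v \<in> carrier_vec n"
    and Lv: "graph_laplacian n E *\<^sub>v v = unit_vec n (i - 1) - unit_vec n (j - 1)"
    and ij: "i \<in> {1..n}" "j \<in> {1..n}"
  shows "resistance_distance n E i j = v $ (i - 1) - v $ (j - 1)"
proof -
  let ?A = "graph_laplacian n E"
  note A = graph_laplacian_carrier[of n E]
  note sym = transpose_graph_laplacian[of n E]
  \<comment> \<open>The range contains all \<open>e\<^sub>a - e\<^sub>b\<close>, so by symmetry the kernel consists of constants;
    no separate connectivity argument is needed.\<close>
  have eq: "w $ a = w $ b"
    if w: "w \<in> carrier_vec n" "?A *\<^sub>v w = 0\<^sub>v n" and ab: "a < b" "b < n" for w a b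
  proof -
    obtain u where u: "u \<in> carrier_vec n" "?A *\<^sub>v u = unit_vec n a - unit_vec n b"
      using pot[OF ab] by blast
    have "w $ a - w $ b = w \<bullet> (?A *\<^sub>v u)"
      using scalar_prod_unit_vec_diff[of w n a b] u w ab by simp
    also have "\<dots> = (?A *\<^sub>v w) \<bullet> u"
      using transpose_vec_mult_scalar[OF A u(1) w(1)] sym by simp
    finally show ?thesis using w u by simp
  qed
  have ker: "w $ a = w $ b"
    if "w \<in> carrier_vec n" "?A *\<^sub>v w = 0\<^sub>v n" "a < n" "b < n" for w a b
    using eq[OF that(1,2) _ that(3)] eq[OF that(1,2) _ that(4)] by (metis linorder_neqE_nat)
  have n: "n > 0" using ij by simp
  obtain X where X: "is_moore_penrose_inverse ?A X"
    using moore_penrose_exists[OF A n sym graph_laplacian_mult_one[OF E] ker] by blast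
  have "resistance_distance n E i j = v \<bullet> (?A *\<^sub>v v)"
    unfolding resistance_distance_def Let_def moore_penrose_inverse_eqI[OF X] Lv[symmetric]
    by (rule moore_penrose_quadratic_form[OF A sym X v])
  also have "\<dots> = v $ (i - 1) - v $ (j - 1)"
    unfolding Lv using ij by (intro scalar_prod_unit_vec_diff v) auto
  finally show ?thesis .
qed

subsection \<open>Fibonacci identities\<close>

lemma F_rec: "F (p + 2) = F (p + 1) + F p"
  using fib_int_rec[of "p + 1"] by (simp add: add.assoc)

lemma F_simps: "F 0 = 0" "F 1 = 1" "F 2 = 1" "F (- 1) = 1"
  by (simp_all add: fib_int_def numeral_2_eq_2)

text \<open>Fits a second-order recurrence read in both directions, so identities extend to negative
  indices.\<close>

lemma int_two_step_induct:
  fixes p :: int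
  assumes "P 0" "P 1"
    and up: "\<And>p. P p \<Longrightarrow> P (p + 1) \<Longrightarrow> P (p + 2)"
    and down: "\<And>p. P (p + 1) \<Longrightarrow> P (p + 2) \<Longrightarrow> P p"
  shows "P p"
proof -
  have "P p \<and> P (p + 1)"
  proof (induction p rule: int_induct[of _ 0])
    case (step1 i)
    then show ?case using up[of i] by (simp add: add.assoc)
  next
    case (step2 i)
    then show ?case using down[of "i - 1"] by (simp add: add.commute)
  qed (use assms in auto)
  then show ?thesis ..
qed

lemma F_add: "F (p + q + 1) = F (p + 1) * F (q + 1) + F p * F q"
proof (induction p rule: int_two_step_induct)
  case (3 p)
  then show ?case using F_rec[of "p + q + 1"] F_rec[of "p + 1"] F_rec[of p]
    by (simp add: algebra_simps)
next
  case (4 p)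
  then show ?case using F_rec[of "p + q + 1"] F_rec[of "p + 1"] F_rec[of p]
    by (simp add: algebra_simps)
qed (use F_rec[of q] F_rec[of 0] F_simps in \<open>auto simp: add.commute\<close>)

lemma F_add': "F (p + q) = F p * F (q + 1) + F (p - 1) * F q"
  using F_add[of "p - 1" q] by simp

text \<open>Used to telescope \<open>row_coeff\<close> and to evaluate the diagonal case of the
  Green function.\<close>

lemma F_add_diff: "F (p + q) = F (p + 1) * F (q + 1) - F (p - 1) * F (q - 1)"
  using F_add'[of p q] F_rec[of "p - 1"] F_rec[of "q - 1"] by (simp add: algebra_simps)

text \<open>With alternating signs this becomes the homogeneous cut equation with coefficients 1, 3,
  1.\<close>

lemma F_rec4: "F (p + 4) = 3 * F (p + 2) - F p"
  using F_rec[of "p + 2"] F_rec[of "p + 1"] F_rec[of p] by (simp add: add.assoc)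

text \<open>The form \<open>x^2 - x * y - y^2\<close> is invariant under a double Fibonacci
  step.\<close>

lemma F_cassini: "F (2 * r + 1)^2 - F (2 * r + 1) * F (2 * r) - F (2 * r)^2 = 1"
proof -
  let ?P = "\<lambda>r. F (2 * r + 1)^2 - F (2 * r + 1) * F (2 * r) - F (2 * r)^2 = 1"
  have step: "?P (r + 1) \<longleftrightarrow> ?P r" for r
  proof -
    have "F (2 * (r + 1)) = F (2 * r + 1) + F (2 * r)"
      "F (2 * (r + 1) + 1) = 2 * F (2 * r + 1) + F (2 * r)"
      using F_rec[of "2 * r"] F_rec[of "2 * r + 1"] by (simp_all add: algebra_simps)
    then show ?thesis by (simp only:) (simp add: power2_eq_square algebra_simps)
  qed
  show ?thesis
  proof (induction r rule: int_induct[of _ 0])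
    case (step2 i)
    then show ?case using step[of "i - 1"] by simp
  qed (simp_all only: step, simp add: F_simps)
qed

text \<open>In terms of \<open>F (p - q)\<close>, \<open>F (p - q - 1)\<close>,
  \<open>F (q + 1)\<close> and \<open>F q\<close>, the two sides differ by a multiple of the Cassini
  relation.\<close>

lemma F_square_add:
  assumes "odd (p - q)"
  shows "F p ^ 2 + F q ^ 2 = F (p + q) * F (p - q)"
proof -
  obtain r where r: "p - q = 2 * r + 1" using assms by (elim oddE)
  define a b where "a = F (2 * r + 1)" and "b = F (2 * r)"
  have p: "p = 2 * r + 1 + q" using r by simp
  have "F p = a * F (q + 1) + b * F q"
    unfolding p a_def b_def using F_add'[of "2 * r + 1" q] by simp
  moreover have "F (p + q) = a * F (2 * q + 1) + b * F (2 * q)"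
    unfolding p a_def b_def using F_add'[of "2 * r + 1" "2 * q"] by (simp add: algebra_simps)
  moreover have "F (2 * q + 1) = F (q + 1)^2 + F q ^ 2"
    using F_add[of q q] by (simp add: power2_eq_square)
  moreover have "F (2 * q) = F q * F (q + 1) + (F (q + 1) - F q) * F q"
    using F_add'[of q q] F_rec[of "q - 1"] by (simp add: add.commute)
  moreover have "a^2 - a * b - b^2 = 1"
    unfolding a_def b_def by (rule F_cassini)
  moreover have "F (p - q) = a" by (simp add: r a_def)
  moreover have "(a * x + b * y)^2 + y^2 - (a * (x^2 + y^2) + b * (y * x + (x - y) * y)) * a
      = y^2 * (1 - (a^2 - a * b - b^2))" for x y
    by (simp add: power2_eq_square algebra_simps)
  ultimately show ?thesis by simp
qed

section \<open>Summands of the first formula and the closed numerator\<close>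

lemma L_eq: "L p = 2 * F (p + 1) - F p"
  using F_rec[of "p - 1"] by (simp add: lucas_int_def add.commute)

definition row_coeff :: "int \<Rightarrow> int \<Rightarrow> real" where
  "row_coeff j i = F i * F (i + 2 * j - 2) - F (i - 1) * F (i + 2 * j - 3)"

text \<open>The product \<open>F i * F (i + 2 * j - 2)\<close> cancels, and
  \<open>F_add_diff\<close> evaluates the rest.\<close>

lemma row_coeff_rec: "row_coeff j (i + 1) + row_coeff j i = F (2 * i + 2 * j - 2)"
  using F_add_diff[of i "i + 2 * j - 2"] by (simp add: row_coeff_def algebra_simps)

text \<open>Expanding by the addition formula cancels the mixed terms and separates \<open>i\<close>
  from \<open>j\<close>.\<close>

lemma row_coeff_eq: "row_coeff j (i + 1) = F (i + 1)^2 * F (2 * j - 1) - F i ^ 2 * F (2 * j - 3)"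
  using F_add[of i "2 * j - 2"] F_add[of i "2 * j - 3"]
  by (simp add: row_coeff_def power2_eq_square algebra_simps)

definition closed_numerator :: "int \<Rightarrow> int \<Rightarrow> int \<Rightarrow> real" where
  "closed_numerator m j k = (F (m + 1))^2 + (F k)^2 * (F (m - 2 * j - k + 3))^2
        + F (m + 1) / 5 *
          (F (m - k) * (real_of_int k * L k - F k)
           + F (m - k + 1) *
             ((real_of_int k - 5) * F (k + 1) + (2 * real_of_int k + 2) * F k))"

lemma closed_numerator_0: "closed_numerator m j 0 = 0"
  by (simp add: closed_numerator_def F_simps power2_eq_square)

text \<open>\<open>F_square_add\<close> turns the right side into squares, of which those depending
  on \<open>j\<close> cancel. What remains is a polynomial identity in \<open>k\<close> and the
  values \<open>a\<close>, \<open>b\<close>, \<open>u\<close>, \<open>w\<close>.\<close>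

lemma closed_numerator_Suc:
  "closed_numerator m j (k + 1) - closed_numerator m j k
    = row_coeff j (k + 1) * F (2 * m - 2 * (k + 1) - 2 * j + 5)"
proof -
  define a b u w where "a = F k" and "b = F (k + 1)" and "u = F (m - k)" and "w = F (m - k + 1)"
  have m: "F (m + 1) = w * b + u * a"
    unfolding a_def b_def u_def w_def using F_add[of "m - k" k] by simp
  have k2: "F (k + 1 + 1) = a + b" unfolding a_def b_def using F_rec[of k] by (simp add: add.commute)
  have u': "F (m - (k + 1)) = w - u"
    unfolding u_def w_def using F_rec[of "m - k - 1"] by (simp add: algebra_simps)
  define c where "c = F (2 * m - 2 * (k + 1) - 2 * j + 5)"
  \<comment> \<open>Here and in \<open>2\<close> the indices add up to that of \<open>c\<close>, and
    their differences \<open>2 * j - 1\<close> and \<open>2 * j - 3\<close> are odd.\<close>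
  have 1: "w^2 + F (m - 2 * j - k + 2)^2 = c * F (2 * j - 1)"
    unfolding c_def w_def using F_square_add[of "m - k + 1" "m - 2 * j - k + 2"]
    by (simp add: algebra_simps)
  have 2: "u^2 + F (m - 2 * j - k + 3)^2 = c * F (2 * j - 3)"
    unfolding c_def u_def using F_square_add[of "m - k" "m - 2 * j - k + 3"]
    by (simp add: algebra_simps)
  have "row_coeff j (k + 1) * c = b^2 * (c * F (2 * j - 1)) - a^2 * (c * F (2 * j - 3))"
    by (simp only: row_coeff_eq a_def b_def) (simp add: algebra_simps)
  also have "\<dots> = b^2 * (w^2 + F (m - 2 * j - k + 2)^2) - a^2 * (u^2 + F (m - 2 * j - k + 3)^2)"
    by (simp only: 1 2)
  finally have rhs: "row_coeff j (k + 1) * c = \<dots>" .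
  have n: "m - 2 * j - (k + 1) + 3 = m - 2 * j - k + 2" "m - (k + 1) + 1 = m - k"
    "real_of_int (k + 1) = real_of_int k + 1" by simp_all
  show ?thesis
    unfolding c_def[symmetric] rhs closed_numerator_def L_eq m k2 u' n
    unfolding a_def[symmetric] b_def[symmetric] u_def[symmetric] w_def[symmetric]
    by (simp add: field_simps power2_eq_square)
qed

lemma sum_row_coeff_closed:
  "(\<Sum>i = 1..int k. row_coeff j i * F (2 * m - 2 * i - 2 * j + 5)) = closed_numerator m j (int k)"
proof (induction k)
  case (Suc k)
  have "{1..int (Suc k)} = insert (int k + 1) {1..int k}" by auto
  then show ?case using Suc closed_numerator_Suc[of m j "int k"] by (simp add: add.commute)
qed (simp add: closed_numerator_0)

subsection \<open>The straight linear 2-tree\<close>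

lemma straight_2tree_edges_subset:
  "straight_2tree_edges n \<subseteq> {{i, j} | i j. i \<in> {1..n} \<and> j \<in> {1..n} \<and> i \<noteq> j}"
  unfolding straight_2tree_edges_def by fastforce

lemma straight_2tree_edges_iff:
  "{Suc a, Suc b} \<in> straight_2tree_edges n
    \<longleftrightarrow> a < n \<and> b < n \<and> a \<noteq> b \<and> a \<le> b + 2 \<and> b \<le> a + 2"
proof
  assume "a < n \<and> b < n \<and> a \<noteq> b \<and> a \<le> b + 2 \<and> b \<le> a + 2"
  then show "{Suc a, Suc b} \<in> straight_2tree_edges n"
    unfolding straight_2tree_edges_def by (intro CollectI exI[of _ "Suc a"] exI[of _ "Suc b"]) auto
qed (auto simp: straight_2tree_edges_def doubleton_eq_iff)

lemma straight_2tree_neighbours: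
  assumes "a < n"
  shows "{b. b < n \<and> b \<noteq> a \<and> {Suc a, Suc b} \<in> straight_2tree_edges n}
    = {b. b < n \<and> b \<noteq> a \<and> a \<le> b + 2 \<and> b \<le> a + 2}"
  using assms by (auto simp: straight_2tree_edges_iff)

text \<open>Vertex \<open>a + 1\<close> has matrix index \<open>a\<close>, and \<open>x i\<close> is the drop from vertex \<open>i\<close> to vertex
  \<open>i + 1\<close>; the value \<open>x 0\<close> does not enter.\<close>

definition potential_of_drops :: "(nat \<Rightarrow> real) \<Rightarrow> nat \<Rightarrow> real" where
  "potential_of_drops x a = - (\<Sum>i<a. x (Suc i))"

lemma potential_of_drops_Suc: "potential_of_drops x (Suc a) = potential_of_drops x a - x (Suc a)"
  by (simp add: potential_of_drops_def)

text \<open>Outflow at a vertex is the difference of the currents through its two adjacent cuts.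
  Near the ends, the conventions for \<open>x 0\<close> and \<open>x n\<close> make the missing
  edges contribute zero.\<close>

lemma straight_2tree_laplacian_potential:
  assumes n: "n \<ge> 3" and a: "a < n"
    and x0: "x 0 = - x 1" and xn: "x n = - x (n - 1)"
    and c0: "c 0 = 0" and cn: "c n = 0"
    and cut: "\<And>i. Suc i < n \<Longrightarrow> x i + 3 * x (Suc i) + x (Suc (Suc i)) = c (Suc i)"
  shows "(graph_laplacian n (straight_2tree_edges n) *\<^sub>v vec n (potential_of_drops x)) $ a
    = c (Suc a) - c a"
proof -
  let ?f = "potential_of_drops x"
  let ?N = "{b. b < n \<and> b \<noteq> a \<and> a \<le> b + 2 \<and> b \<le> a + 2}"
  have "(graph_laplacian n (straight_2tree_edges n) *\<^sub>v vec n ?f) $ a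
    = (\<Sum>b\<in>?N. vec n ?f $ a - vec n ?f $ b)"
    using graph_laplacian_mult_vec[OF straight_2tree_edges_subset _ a]
    by (simp add: straight_2tree_neighbours[OF a])
  also have "\<dots> = (\<Sum>b\<in>?N. ?f a - ?f b)" using a by (intro sum.cong) auto
  also have "\<dots> = c (Suc a) - c a"
  proof -
    \<comment> \<open>The cases record which of the four possible neighbours exist; for
      \<open>n = 3\<close> the middle vertex is next to both ends.\<close>
    consider "a = 0" | "a = 1" "n = 3" | "a = 1" "n > 3"
      | d where "a = Suc (Suc d)" "n = Suc a"
      | d where "a = Suc (Suc d)" "n = Suc (Suc a)"
      | d where "a = Suc (Suc d)" "n > Suc (Suc a)"
    proof (cases "a < 2")
      case True
      then show ?thesis using that(1-3) n by linarith
    next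
      case False
      then obtain d where "a = Suc (Suc d)" by (metis add_2_eq_Suc le_Suc_ex not_less)
      then show ?thesis using that(4-6)[of d] a by linarith
    qed
    then show ?thesis
    proof cases
      case 1
      then have "?N = {1, 2}" using n by auto
      then show ?thesis using 1 n x0 c0 cut[of 0]
        by (simp add: potential_of_drops_Suc numeral_2_eq_2)
    next
      case 2
      then have "?N = {0, 2}" by auto
      then show ?thesis using 2 x0 xn cut[of 0] cut[of 1]
        by (simp add: potential_of_drops_Suc numeral_2_eq_2 numeral_3_eq_3)
    next
      case 3
      then have "?N = {0, 2, 3}" by auto
      then show ?thesis using 3 x0 cut[of 0] cut[of 1]
        by (simp add: potential_of_drops_Suc numeral_2_eq_2 numeral_3_eq_3)
    next
      case 4
      then have "?N = {d, Suc d}" by auto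
      then show ?thesis using 4 xn cn cut[of "Suc d"]
        by (simp add: potential_of_drops_Suc)
    next
      case 5
      then have "?N = {d, Suc d, Suc (Suc (Suc d))}" by auto
      then show ?thesis using 5 xn cut[of "Suc d"] cut[of "Suc (Suc d)"]
        by (simp add: potential_of_drops_Suc)
    next
      case 6
      then have "?N = {d, Suc d, Suc (Suc (Suc d)), Suc (Suc (Suc (Suc d)))}" by auto
      then show ?thesis using 6 cut[of "Suc d"] cut[of "Suc (Suc d)"]
        by (simp add: potential_of_drops_Suc)
    qed
  qed
  finally show ?thesis .
qed

text \<open>The factors \<open>(- 1) ^ i * F (2 * i - 1)\<close> and
  \<open>(- 1) ^ i * F (2 * (n - i) - 1)\<close> solve the homogeneous equations with the left and
  right boundary convention respectively; the denominator normalises the source to 1.\<close>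

definition cut_green :: "nat \<Rightarrow> nat \<Rightarrow> nat \<Rightarrow> real" where
  "cut_green n i l = (- 1) ^ (i + l) * F (2 * int (min i l) - 1)
     * F (2 * (int n - int (max i l)) - 1) / F (2 * int n - 2)"

lemma cut_green_commute: "cut_green n i l = cut_green n l i"
  by (simp add: cut_green_def min.commute max.commute add.commute)

lemma F_pos: "p > 0 \<Longrightarrow> F p > 0"
  by (simp add: fib_int_def fib_neq_0_nat)

lemma cut_green_left: "l \<ge> 1 \<Longrightarrow> cut_green n 0 l = - cut_green n 1 l"
  by (simp add: cut_green_def F_simps)

lemma cut_green_right: "l < n \<Longrightarrow> cut_green n n l = - cut_green n (n - 1) l"
  by (cases n) (simp_all add: cut_green_def F_simps less_Suc_eq_le)

text \<open>Off the diagonal only one factor varies and \<open>F_rec4\<close> applies. On the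
  diagonal a Wronskian-type expression equals the denominator.\<close>

lemma cut_green_rec:
  assumes l: "1 \<le> l" "l < n" and i: "Suc i < n"
  shows "cut_green n i l + 3 * cut_green n (Suc i) l + cut_green n (Suc (Suc i)) l
    = (if Suc i = l then 1 else 0)"
proof -
  have F0: "F (2 * int n - 2) > 0" using l by (intro F_pos) auto
  consider "Suc i < l" | "Suc i = l" | "l < Suc i" by linarith
  then show ?thesis
  proof cases
    case 1
    then have "min i l = i" "min (Suc i) l = Suc i" "min (Suc (Suc i)) l = Suc (Suc i)"
      "max i l = l" "max (Suc i) l = l" "max (Suc (Suc i)) l = l" by auto
    moreover have "F (2 * int (Suc (Suc i)) - 1) = 3 * F (2 * int (Suc i) - 1) - F (2 * int i - 1)"
      using F_rec4[of "2 * int i - 1"] by (simp add: algebra_simps)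
    ultimately show ?thesis using 1
      by (simp only: cut_green_def) (simp add: diff_divide_distrib add_divide_distrib algebra_simps)
  next
    case 2
    then have "min i l = i" "min (Suc i) l = Suc i" "min (Suc (Suc i)) l = Suc i"
      "max i l = Suc i" "max (Suc i) l = Suc i" "max (Suc (Suc i)) l = Suc (Suc i)"
      by auto
    moreover define A B C D E where "A = F (2 * int i - 1)" and "B = F (2 * int (Suc i) - 1)"
      and "C = F (2 * (int n - int (Suc i)) - 1)" and "D = F (2 * (int n - int (Suc (Suc i))) - 1)"
      and "E = F (2 * int n - 2)"
    moreover have "(- 1 :: real) ^ (i + l) = -1" "(- 1 :: real) ^ (Suc i + l) = 1"
      "(- 1 :: real) ^ (Suc (Suc i) + l) = -1" using 2 by auto
    ultimately have g: "cut_green n i l = - (A * C / E)" "cut_green n (Suc i) l = B * C / E"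
      "cut_green n (Suc (Suc i)) l = - (B * D / E)"
      by (simp_all add: cut_green_def)
    \<comment> \<open>Continues the left factor one step past the source, as
      \<open>F_add_diff\<close> needs.\<close>
    have 3: "F (2 * int i + 3) = 3 * B - A"
      unfolding A_def B_def using F_rec4[of "2 * int i - 1"] by (simp add: algebra_simps)
    have "E = F (2 * int i + 3) * C - B * D"
      unfolding B_def C_def D_def E_def
      using F_add_diff[of "2 * int i + 2" "2 * int n - 2 * int i - 4"]
      by (simp add: algebra_simps)
    also note 3
    finally have "3 * (B * C) - A * C - B * D = E" by (simp add: algebra_simps)
    moreover have "E > 0" using F0 by (simp add: E_def)
    ultimately have "(3 * (B * C) - A * C - B * D) / E = 1" by simp
    then show ?thesis using 2 unfolding g by (simp add: diff_divide_distrib)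
  next
    case 3
    then have "min i l = l" "min (Suc i) l = l" "min (Suc (Suc i)) l = l"
      "max i l = i" "max (Suc i) l = Suc i" "max (Suc (Suc i)) l = Suc (Suc i)" by auto
    moreover have "F (2 * (int n - int i) - 1) = 3 * F (2 * (int n - int (Suc i)) - 1)
        - F (2 * (int n - int (Suc (Suc i))) - 1)"
      using F_rec4[of "2 * int n - 2 * int i - 5"] by (simp add: algebra_simps)
    ultimately show ?thesis using 3
      by (simp only: cut_green_def) (simp add: diff_divide_distrib add_divide_distrib algebra_simps)
  qed
qed

text \<open>A unit current from \<open>s\<close> to \<open>t\<close> crosses exactly the cuts in
  \<open>{s..<t}\<close>, so the Green columns for these cuts superpose to the drops.\<close>

lemma straight_2tree_potential:
  assumes n: "n \<ge> 3" and st: "1 \<le> s" "s < t" "t \<le> n"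
  defines "x \<equiv> \<lambda>i. \<Sum>l\<in>{s..<t}. cut_green n i l"
  shows "graph_laplacian n (straight_2tree_edges n) *\<^sub>v vec n (potential_of_drops x)
    = unit_vec n (s - 1) - unit_vec n (t - 1)"
proof (intro eq_vecI)
  fix a assume "a < dim_vec (unit_vec n (s - 1) - unit_vec n (t - 1) :: real vec)"
  then have a: "a < n" by simp
  define c :: "nat \<Rightarrow> real" where "c i = (if s \<le> i \<and> i < t then 1 else 0)" for i
  have "x i + 3 * x (Suc i) + x (Suc (Suc i)) = c (Suc i)" if "Suc i < n" for i
  proof -
    have "x i + 3 * x (Suc i) + x (Suc (Suc i)) = (\<Sum>l\<in>{s..<t}. if Suc i = l then 1 else 0)"
      unfolding x_def sum_distrib_left sum.distrib[symmetric]
      using that st by (intro sum.cong cut_green_rec) auto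
    then show ?thesis by (simp add: c_def)
  qed
  moreover have "x 0 = - x 1" "x n = - x (n - 1)"
    unfolding x_def sum_negf[symmetric] using st
    by (auto intro!: sum.cong simp: cut_green_left cut_green_right)
  moreover have "c 0 = 0" "c n = 0" using st by (auto simp: c_def)
  ultimately have "(graph_laplacian n (straight_2tree_edges n) *\<^sub>v vec n (potential_of_drops x)) $ a
    = c (Suc a) - c a"
    by (intro straight_2tree_laplacian_potential n a)
  also have "\<dots> = (unit_vec n (s - 1) - unit_vec n (t - 1)) $ a"
    using a st by (auto simp: c_def unit_vec_def)
  finally show "(graph_laplacian n (straight_2tree_edges n) *\<^sub>v vec n (potential_of_drops x)) $ a
    = (unit_vec n (s - 1) - unit_vec n (t - 1)) $ a" .
qed (simp add: graph_laplacian_def)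

lemma resistance_distance_straight_2tree:
  assumes n: "n \<ge> 3" and st: "1 \<le> s" "s < t" "t \<le> n"
  shows "resistance_distance n (straight_2tree_edges n) s t
    = (\<Sum>i\<in>{s..<t}. \<Sum>l\<in>{s..<t}. cut_green n i l)"
proof -
  define x where "x i = (\<Sum>l\<in>{s..<t}. cut_green n i l)" for i
  have pot: "\<exists>u \<in> carrier_vec n. graph_laplacian n (straight_2tree_edges n) *\<^sub>v u
      = unit_vec n a - unit_vec n b" if "a < b" "b < n" for a b
    using straight_2tree_potential[OF n, of "Suc a" "Suc b"] that by (intro bexI) auto
  have "resistance_distance n (straight_2tree_edges n) s t
      = vec n (potential_of_drops x) $ (s - 1) - vec n (potential_of_drops x) $ (t - 1)"
    using straight_2tree_potential[OF n st] st unfolding x_def[abs_def]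
    by (intro resistance_distance_eq_potential_difference[OF straight_2tree_edges_subset pot]) auto
  also have "\<dots> = (\<Sum>i<t - 1. x (Suc i)) - (\<Sum>i<s - 1. x (Suc i))"
    using st by (simp add: potential_of_drops_def)
  also have "\<dots> = (\<Sum>i = s - 1..<t - 1. x (Suc i))"
    using sum_diff_nat_ivl[of 0 "s - 1" "t - 1" "\<lambda>i. x (Suc i)"] st
    by (simp add: atLeast0LessThan)
  also have "\<dots> = (\<Sum>i = s..<t. x i)"
    using sum.shift_bounds_Suc_ivl[of x "s - 1" "t - 1"] st by simp
  finally show ?thesis by (simp add: x_def)
qed

text \<open>Raising \<open>k\<close> flips every old sign, so both sides obey
  \<open>row_coeff_rec\<close>. The right side is the new row, its mirror column and the corner of
  the Green matrix, up to a common factor.\<close>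

lemma row_coeff_alternating_sum:
  "row_coeff (int j) (int k + 1)
    = 2 * (\<Sum>i = j..<j + k. (- 1) ^ (i + (j + k)) * F (2 * int i - 1)) + F (2 * int (j + k) - 1)"
proof (induction k)
  case 0
  show ?case by (simp add: row_coeff_def F_simps)
next
  case (Suc k)
  have "(\<Sum>i = j..<j + Suc k. (- 1) ^ (i + (j + Suc k)) * F (2 * int i - 1))
    = - (\<Sum>i = j..<j + k. (- 1) ^ (i + (j + k)) * F (2 * int i - 1)) - F (2 * int (j + k) - 1)"
    by (simp add: sum_negf flip: power_add)
  then show ?case
    using Suc row_coeff_rec[of "int j" "int k + 1"] F_rec[of "2 * int (j + k) - 1"]
    by (simp add: algebra_simps)
qed

text \<open>Induction enlarges the index square by one row and one column, equal by symmetry, and a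
  corner.\<close>

lemma sum_cut_green:
  "(\<Sum>i = j..<j + k. \<Sum>l = j..<j + k. cut_green n i l)
    = (\<Sum>i = 1..int k. row_coeff (int j) i * F (2 * int n - 2 * i - 2 * int j + 1)) / F (2 * int n - 2)"
proof (induction k)
  case (Suc k)
  \<comment> \<open>In every new entry \<open>j + k\<close> is the larger index, so \<open>C\<close>
    is a common factor.\<close>
  define C where "C = F (2 * (int n - int (j + k)) - 1) / F (2 * int n - 2)"
  have g: "cut_green n i (j + k) = (- 1) ^ (i + (j + k)) * F (2 * int i - 1) * C" if "i \<le> j + k" for i
    using that by (simp add: cut_green_def C_def min_def max_def)
  have "(\<Sum>l = j..<j + k. cut_green n (j + k) l) = (\<Sum>i = j..<j + k. cut_green n i (j + k))"
    by (intro sum.cong cut_green_commute refl)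
  then have "(\<Sum>i = j..<j + Suc k. \<Sum>l = j..<j + Suc k. cut_green n i l)
    = (\<Sum>i = j..<j + k. \<Sum>l = j..<j + k. cut_green n i l)
      + (2 * (\<Sum>i = j..<j + k. cut_green n i (j + k)) + cut_green n (j + k) (j + k))"
    by (simp add: sum.distrib)
  also have "2 * (\<Sum>i = j..<j + k. cut_green n i (j + k)) + cut_green n (j + k) (j + k)
      = row_coeff (int j) (int k + 1) * C"
    unfolding row_coeff_alternating_sum
    by (simp add: g sum_distrib_right sum_distrib_left distrib_right mult.assoc)
  finally have "(\<Sum>i = j..<j + Suc k. \<Sum>l = j..<j + Suc k. cut_green n i l)
    = (\<Sum>i = j..<j + k. \<Sum>l = j..<j + k. cut_green n i l) + row_coeff (int j) (int k + 1) * C"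
    by simp
  moreover have "{1..int (Suc k)} = insert (int k + 1) {1..int k}" by auto
  moreover have "C = F (2 * int n - 2 * (int k + 1) - 2 * int j + 1) / F (2 * int n - 2)"
    by (simp add: C_def algebra_simps)
  ultimately show ?case using Suc by (simp add: add_divide_distrib)
qed simp

theorem theorem4p4:
  fixes n m j k :: nat
  assumes "n \<ge> 3" and "m = n - 2"
    and "1 \<le> j" and "j < n" and "k \<ge> 1" and "j + k \<le> n"
  shows "resistance_distance n (straight_2tree_edges n) j (j + k) =
      (\<Sum>i = 1..int k.
          (F i * F (i + 2 * int j - 2) - F (i - 1) * F (i + 2 * int j - 3)) *
          F (2 * int m - 2 * i - 2 * int j + 5)) / F (2 * int m + 2)
    \<and> resistance_distance n (straight_2tree_edges n) j (j + k) =
      ((F (int m + 1))^2 + (F (int k))^2 * (F (int m - 2 * int j - int k + 3))^2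
        + F (int m + 1) / 5 *
          (F (int m - int k) * (real k * L (int k) - F (int k))
           + F (int m - int k + 1) *
             ((real k - 5) * F (int k + 1) + (2 * real k + 2) * F (int k))))
      / F (2 * int m + 2)"
proof -
  \<comment> \<open>Since \<open>n \<ge> 3\<close>, the natural-number difference
    \<open>n - 2\<close> is not truncated.\<close>
  have n: "2 * int n - 2 = 2 * int m + 2"
    "2 * int n - 2 * i - 2 * int j + 1 = 2 * int m - 2 * i - 2 * int j + 5" for i
    using assms by simp_all
  have "resistance_distance n (straight_2tree_edges n) j (j + k)
      = (\<Sum>i = j..<j + k. \<Sum>l = j..<j + k. cut_green n i l)"
    using assms by (intro resistance_distance_straight_2tree) auto
  also note sum_cut_green
  finally have "resistance_distance n (straight_2tree_edges n) j (j + k) =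
      (\<Sum>i = 1..int k. row_coeff (int j) i * F (2 * int m - 2 * i - 2 * int j + 5)) / F (2 * int m + 2)"
    unfolding n .
  then show ?thesis
    using sum_row_coeff_closed[of "int j" "int m" k]
    by (simp only: row_coeff_def closed_numerator_def of_int_of_nat_eq)
qed

end
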